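(* Let $C\subset\mathbb{R}^m$ be a closed convex cone, let $A_1,\dots,A_n,B\in\mathbb{R}^m$ and $c\in\mathbb{R}^n$. Consider the primal program $$(P)\quad \min\Big\{\sum_{i=1}^n c_i x_i:\ \sum_{i=1}^n A_i x_i-B\in C,\ x\in\mathbb{R}^n\Big\}$$ and the dual program $$(D)\quad \max\big\{B\cdot Y:\ A_i\cdot Y=c_i\ \forall i\in\{1,\dots,n\},\ Y\in C^*\big\}.$$ If both $(P)$ and $(D)$ are strictly feasible, then they have the same optimum value and both programs reach it.
   Context: A convex cone is a (non-empty) set closed under linear combinations with positive coefficients. The dual cone is $C^*=\{Y\in\mathbb{R}^m:\ X\cdot Y\ge 0\ \forall X\in C\}$, where $\cdot$ is the standard scalar product. $(P)$ is strictly feasible if there is $x\in\mathbb{R}^n$ with $\sum_{i=1}^n A_ix_i-B$ in the (topological) interior of $C$ in $\mathbb{R}^m$; $(D)$ is strictly feasible if there is $Y$ in the interior of $C^*$ with $A_i\cdot Y=c_i$ for all $i$. "Reaching" the optimum means that the infimum (resp. supremum) is attained by a feasible point. *)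

theory Defs
  imports "HOL-Analysis.Analysis"
begin

text \<open>
  The library predicate \<open>convex_cone\<close> asks for closure under nonnegative scalars, so it forces
  \<open>0 \<in> C\<close>.  For closed sets this is the same as being non-empty and closed under linear
  combinations with strictly positive coefficients:
\<close>

lemma closed_convex_cone_iff:
  fixes C :: "'a::real_normed_vector set"
  assumes "closed C"
  shows "convex_cone C \<longleftrightarrow>
    C \<noteq> {} \<and> (\<forall>x\<in>C. \<forall>y\<in>C. \<forall>a>0. \<forall>b>0. a *\<^sub>R x + b *\<^sub>R y \<in> C)"
    (is "_ \<longleftrightarrow> ?P")
proof
  assume "convex_cone C"
  then show ?P
    by (auto simp: convex_cone_iff)
next
  assume P: ?P
  then have ne: "C \<noteq> {}"
    and comb: "\<And>x y a b. x \<in> C \<Longrightarrow> y \<in> C \<Longrightarrow> a > 0 \<Longrightarrow> b > 0 \<Longrightarrow> a *\<^sub>R x + b *\<^sub>R y \<in> C"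
    by blast+
  have scale: "a *\<^sub>R x \<in> C" if "x \<in> C" "a > 0" for a x
    using comb[OF that(1) that(1), of "a/2" "a/2"] that(2)
    by (simp flip: scaleR_left_distrib)
  have zero: "0 \<in> C"
  proof -
    obtain x where x: "x \<in> C" using ne by blast
    have "(\<lambda>n. inverse (real (Suc n)) *\<^sub>R x) \<longlonglongrightarrow> 0 *\<^sub>R x"
      by (intro tendsto_intros LIMSEQ_inverse_real_of_nat)
    moreover have "inverse (real (Suc n)) *\<^sub>R x \<in> C" for n
      using scale[OF x] by simp
    ultimately show ?thesis
      using closed_sequentially[OF assms, of "\<lambda>n. inverse (real (Suc n)) *\<^sub>R x"] by simp
  qed
  have scale0: "a *\<^sub>R x \<in> C" if "x \<in> C" "a \<ge> 0" for a x
    using that scale zero by (cases "a = 0") auto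
  have add: "x + y \<in> C" if "x \<in> C" "y \<in> C" for x y
    using comb[OF that, of 1 1] by simp
  show "convex_cone C"
    using ne scale0 add by (auto simp: convex_cone_iff zero)
qed

definition dual_cone :: "(real^'m) set \<Rightarrow> (real^'m) set" where
  "dual_cone C = {Y. \<forall>X\<in>C. X \<bullet> Y \<ge> 0}"

definition primal_slack :: "('n::finite \<Rightarrow> real^'m) \<Rightarrow> real^'m \<Rightarrow> real^'n \<Rightarrow> real^'m" where
  "primal_slack A B x = (\<Sum>i\<in>UNIV. x $ i *\<^sub>R A i) - B"

definition primal_objective :: "real^'n \<Rightarrow> real^'n \<Rightarrow> real" where
  "primal_objective c x = (\<Sum>i\<in>UNIV. c $ i * x $ i)"

definition primal_feasible ::
    "(real^'m) set \<Rightarrow> ('n::finite \<Rightarrow> real^'m) \<Rightarrow> real^'m \<Rightarrow> (real^'n) set" where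
  "primal_feasible C A B = {x. primal_slack A B x \<in> C}"

definition dual_feasible ::
    "(real^'m) set \<Rightarrow> ('n::finite \<Rightarrow> real^'m) \<Rightarrow> real^'n \<Rightarrow> (real^'m) set" where
  "dual_feasible C A c = {Y. (\<forall>i. A i \<bullet> Y = c $ i) \<and> Y \<in> dual_cone C}"

definition primal_strictly_feasible ::
    "(real^'m) set \<Rightarrow> ('n::finite \<Rightarrow> real^'m) \<Rightarrow> real^'m \<Rightarrow> bool" where
  "primal_strictly_feasible C A B \<longleftrightarrow> (\<exists>x. primal_slack A B x \<in> interior C)"

definition dual_strictly_feasible ::
    "(real^'m) set \<Rightarrow> ('n::finite \<Rightarrow> real^'m) \<Rightarrow> real^'n \<Rightarrow> bool" where
  "dual_strictly_feasible C A c \<longleftrightarrow>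
     (\<exists>Y. (\<forall>i. A i \<bullet> Y = c $ i) \<and> Y \<in> interior (dual_cone C))"

text \<open>
  Optimum values are extended reals, so that they are meaningful also for infeasible or
  unbounded programs (on type \<open>real\<close>, the infimum of such a set is unspecified).
\<close>

definition primal_value ::
    "(real^'m) set \<Rightarrow> ('n::finite \<Rightarrow> real^'m) \<Rightarrow> real^'m \<Rightarrow> real^'n \<Rightarrow> ereal" where
  "primal_value C A B c = (INF x\<in>primal_feasible C A B. ereal (primal_objective c x))"

definition dual_value ::
    "(real^'m) set \<Rightarrow> ('n::finite \<Rightarrow> real^'m) \<Rightarrow> real^'m \<Rightarrow> real^'n \<Rightarrow> ereal" where
  "dual_value C A B c = (SUP Y\<in>dual_feasible C A c. ereal (B \<bullet> Y))"

end

theory Submission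
  imports Defs
begin

text \<open>
  An interior point of a cone pairs coercively with the dual cone.  Up to an additive constant the
  primal objective is the pairing of the slack with a strictly feasible \<open>Y\<close>, and the dual objective
  is minus the pairing of \<open>Y\<close> with a strictly feasible slack, so both programs minimise a coercive
  linear functional over a closed set and are attained.  With \<open>p\<close> the primal optimum, a hyperplane
  separating the affine set of all pairs (slack, objective) from \<open>C \<times> {..<p}\<close> yields a dual
  feasible point of value at least \<open>p\<close>; strict primal feasibility rules out a vertical hyperplane.
\<close>

text \<open>Walking from \<open>P\<close> a distance \<open>e\<close> against the direction of
  \<open>Y\<close> stays in a ball inside \<open>K\<close>, and lowers the pairing with
  \<open>Y\<close> by exactly \<open>e * norm Y\<close>.\<close>

lemma interior_inner_coercive:
  fixes K :: "'a::real_inner set"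
  assumes "P \<in> interior K"
  shows "\<exists>e>0. \<forall>Y. (\<forall>X\<in>K. X \<bullet> Y \<ge> 0) \<longrightarrow> P \<bullet> Y \<ge> e * norm Y"
proof -
  obtain e where e: "e > 0" "cball P e \<subseteq> K"
    using assms by (auto simp: mem_interior_cball)
  have "P \<bullet> Y \<ge> e * norm Y" if Y: "\<forall>X\<in>K. X \<bullet> Y \<ge> 0" for Y
  proof -
    \<comment> \<open>\<open>sgn Y\<close> has norm 1, or is 0 when \<open>Y = 0\<close>; either way
      the point lies in \<open>cball P e\<close>.\<close>
    have "P - e *\<^sub>R sgn Y \<in> K"
      using e by (intro subsetD[OF e(2)]) (simp add: dist_norm norm_sgn)
    then have "0 \<le> (P - e *\<^sub>R sgn Y) \<bullet> Y"
      using Y by blast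
    also have "\<dots> = P \<bullet> Y - e * norm Y"
      by (cases "Y = 0") (simp_all add: inner_diff_left sgn_div_norm dot_square_norm power2_eq_square)
    finally show ?thesis by simp
  qed
  with e(1) show ?thesis by blast
qed

text \<open>Coercivity bounds the sublevel set through any point of \<open>S\<close>, so this set is
  compact and its minimum is the minimum over \<open>S\<close>.\<close>

lemma coercive_inner_attains_min:
  fixes S :: "'a::euclidean_space set"
  assumes "closed S" "S \<noteq> {}" "e > 0" and coercive: "\<And>X. X \<in> S \<Longrightarrow> P \<bullet> X \<ge> e * norm X"
  shows "\<exists>X\<in>S. \<forall>Z\<in>S. P \<bullet> X \<le> P \<bullet> Z"
proof -
  obtain X0 where X0: "X0 \<in> S" using assms by blast
  define T where "T = S \<inter> {X. P \<bullet> X \<le> P \<bullet> X0}"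
  have "T \<subseteq> cball 0 (P \<bullet> X0 / e)"
  proof
    fix X assume "X \<in> T"
    then have "e * norm X \<le> P \<bullet> X0"
      using coercive[of X] by (auto simp: T_def)
    then show "X \<in> cball 0 (P \<bullet> X0 / e)"
      using \<open>e > 0\<close> by (simp add: field_simps)
  qed
  then have "bounded T"
    using bounded_cball bounded_subset by blast
  moreover have "closed T"
    unfolding T_def using assms(1) by (intro closed_Int closed_halfspace_le)
  ultimately have "compact T"
    by (simp add: compact_eq_bounded_closed)
  moreover have "X0 \<in> T" by (simp add: T_def X0)
  ultimately obtain X where X: "X \<in> T" "\<And>Z. Z \<in> T \<Longrightarrow> P \<bullet> X \<le> P \<bullet> Z"
    using continuous_attains_inf[of T "\<lambda>X. P \<bullet> X"] continuous_on_inner[OF continuous_on_const continuous_on_id]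
    by blast
  show ?thesis
  proof (intro bexI ballI)
    show "X \<in> S" using X by (simp add: T_def)
    show "P \<bullet> X \<le> P \<bullet> Z" if "Z \<in> S" for Z
      using X(2)[of Z] X(2)[OF \<open>X0 \<in> T\<close>] that by (cases "P \<bullet> Z \<le> P \<bullet> X0") (auto simp: T_def)
  qed
qed

lemma inner_primal_slack:
  "Y \<bullet> primal_slack A B x = (\<Sum>i\<in>UNIV. x $ i * (A i \<bullet> Y)) - B \<bullet> Y"
  by (simp add: primal_slack_def inner_diff_right inner_sum_right inner_commute)

text \<open>Any \<open>Y\<close> solving the dual equations makes the objective a function of the
  slack alone. Weak duality and both attainment results rest on this identity.\<close>

lemma primal_objective_eq:
  assumes "\<And>i. A i \<bullet> Y = c $ i"
  shows "primal_objective c x = Y \<bullet> primal_slack A B x + B \<bullet> Y"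
  by (simp add: inner_primal_slack assms primal_objective_def mult.commute)

lemma range_primal_slack:
  "range (primal_slack A B) = (\<lambda>X. X - B) ` range (\<lambda>x. \<Sum>i\<in>UNIV. x $ i *\<^sub>R A i)"
  by (auto simp: primal_slack_def)

lemma linear_vec_combination:
  fixes A :: "'n::finite \<Rightarrow> 'a::real_vector"
  shows "linear (\<lambda>x::real^'n. \<Sum>i\<in>UNIV. x $ i *\<^sub>R A i)"
  by (rule linearI) (auto simp: scaleR_add_left sum.distrib scaleR_sum_right)

lemma closed_range_primal_slack:
  fixes A :: "'n::finite \<Rightarrow> real^'m"
  shows "closed (range (primal_slack A B))"
proof -
  have "subspace (range (\<lambda>x::real^'n. \<Sum>i\<in>UNIV. x $ i *\<^sub>R A i))"
    using linear_subspace_image[OF linear_vec_combination subspace_UNIV] .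
  from closed_translation_subtract[OF closed_subspace[OF this]] show ?thesis
    unfolding range_primal_slack .
qed

lemma closed_dual_feasible: "closed (dual_feasible C A c)"
proof -
  have "dual_feasible C A c = (\<Inter>i. {Y. A i \<bullet> Y = c $ i}) \<inter> (\<Inter>X\<in>C. {Y. X \<bullet> Y \<ge> 0})"
    by (auto simp: dual_feasible_def dual_cone_def)
  then show ?thesis
    by (auto intro!: closed_Int closed_INT closed_hyperplane closed_halfspace_ge)
qed

lemma weak_duality:
  assumes "x \<in> primal_feasible C A B" "Y \<in> dual_feasible C A c"
  shows "B \<bullet> Y \<le> primal_objective c x"
  using assms primal_objective_eq[of A Y c x B]
  by (auto simp: primal_feasible_def dual_feasible_def dual_cone_def inner_commute)

text \<open>The minimum is taken over slacks instead of over \<open>x\<close>: when the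
  \<open>A i\<close> are linearly dependent, sublevel sets in \<open>x\<close> can be
  unbounded.\<close>

lemma primal_attained:
  fixes C :: "(real^'m) set"
  assumes "closed C" "dual_strictly_feasible C A c" "primal_feasible C A B \<noteq> {}"
  shows "\<exists>x\<in>primal_feasible C A B. \<forall>z\<in>primal_feasible C A B.
    primal_objective c x \<le> primal_objective c z"
proof -
  obtain Y where Y: "\<And>i. A i \<bullet> Y = c $ i" "Y \<in> interior (dual_cone C)"
    using assms(2) by (auto simp: dual_strictly_feasible_def)
  obtain e where e: "e > 0" "\<And>X. \<forall>Z\<in>dual_cone C. Z \<bullet> X \<ge> 0 \<Longrightarrow> Y \<bullet> X \<ge> e * norm X"
    using interior_inner_coercive[OF Y(2)] by blast
  let ?S = "range (primal_slack A B) \<inter> C"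
  have "closed ?S"
    using assms(1) closed_range_primal_slack by blast
  moreover have "?S \<noteq> {}"
    using assms(3) by (auto simp: primal_feasible_def)
  \<comment> \<open>Coercivity applies to \<open>X\<close> because \<open>C\<close> lies in the dual
    of \<open>dual_cone C\<close>.\<close>
  moreover have "Y \<bullet> X \<ge> e * norm X" if "X \<in> ?S" for X
    using that by (intro e(2)) (auto simp: dual_cone_def inner_commute)
  ultimately obtain X where X: "X \<in> ?S" "\<And>Z. Z \<in> ?S \<Longrightarrow> Y \<bullet> X \<le> Y \<bullet> Z"
    using coercive_inner_attains_min[of ?S e Y] e(1) by blast
  then obtain x where x: "X = primal_slack A B x" by blast
  show ?thesis
  proof (intro bexI ballI)
    show "x \<in> primal_feasible C A B"
      using X x by (simp add: primal_feasible_def)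
    show "primal_objective c x \<le> primal_objective c z" if "z \<in> primal_feasible C A B" for z
      using X(2)[of "primal_slack A B z"] that x
      by (simp add: primal_objective_eq[of A Y c _ B, OF Y(1)] primal_feasible_def)
  qed
qed

text \<open>For a fixed strictly feasible \<open>x\<close>, \<open>B \<bullet> Y\<close> is a
  constant minus the pairing of \<open>Y\<close> with the slack of \<open>x\<close>, so maximising
  one minimises the other.\<close>

lemma dual_attained:
  fixes C :: "(real^'m) set"
  assumes "primal_strictly_feasible C A B" "dual_feasible C A c \<noteq> {}"
  shows "\<exists>Y\<in>dual_feasible C A c. \<forall>Z\<in>dual_feasible C A c. B \<bullet> Z \<le> B \<bullet> Y"
proof -
  obtain x where x: "primal_slack A B x \<in> interior C"
    using assms(1) by (auto simp: primal_strictly_feasible_def)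
  obtain e where e: "e > 0"
    "\<And>Y. \<forall>X\<in>C. X \<bullet> Y \<ge> 0 \<Longrightarrow> primal_slack A B x \<bullet> Y \<ge> e * norm Y"
    using interior_inner_coercive[OF x] by blast
  have "primal_slack A B x \<bullet> Y \<ge> e * norm Y" if "Y \<in> dual_feasible C A c" for Y
    using that by (intro e(2)) (auto simp: dual_feasible_def dual_cone_def)
  then obtain Y where Y: "Y \<in> dual_feasible C A c"
    "\<And>Z. Z \<in> dual_feasible C A c \<Longrightarrow> primal_slack A B x \<bullet> Y \<le> primal_slack A B x \<bullet> Z"
    using coercive_inner_attains_min[OF closed_dual_feasible assms(2) e(1), of "primal_slack A B x"]
    by blast
  show ?thesis
  proof (intro bexI ballI)
    show "B \<bullet> Z \<le> B \<bullet> Y" if Z: "Z \<in> dual_feasible C A c" for Z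
      using Y(2)[OF Z] Y(1) Z primal_objective_eq[of A Y c x B] primal_objective_eq[of A Z c x B]
      by (simp add: dual_feasible_def inner_commute)
  qed fact
qed

lemma linear_bounded_above_imp_zero:
  fixes f :: "'a::real_vector \<Rightarrow> real"
  assumes "linear f" "\<And>x. f x \<le> b"
  shows "f x = 0"
proof (rule ccontr)
  assume "f x \<noteq> 0"
  then have "f (((b + 1) / f x) *\<^sub>R x) = b + 1"
    by (simp add: linear_cmul[OF assms(1)])
  then show False using assms(2)[of "((b + 1) / f x) *\<^sub>R x"] by simp
qed

text \<open>A negative value could be scaled within the cone to
  \<open>- (\<bar>b\<bar> + 1)\<close>, which is below \<open>b\<close>.\<close>

lemma cone_bounded_below_imp_nonneg:
  assumes "convex_cone C" "\<And>X. X \<in> C \<Longrightarrow> a \<bullet> X \<ge> b" "X \<in> C"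
  shows "a \<bullet> X \<ge> 0"
proof (rule ccontr)
  assume neg: "\<not> a \<bullet> X \<ge> 0"
  let ?t = "(\<bar>b\<bar> + 1) / \<bar>a \<bullet> X\<bar>"
  have "?t *\<^sub>R X \<in> C"
    using assms(1,3) by (intro convex_cone_scaleR divide_nonneg_nonneg) auto
  then have "b \<le> ?t * (a \<bullet> X)"
    using assms(2) by fastforce
  then show False using neg by (simp add: abs_of_neg)
qed

text \<open>Here \<open>p\<close> is any lower bound of the primal values. If
  \<open>(a, \<mu>)\<close> is the normal of the separating hyperplane, then
  \<open>\<mu> < 0\<close> and the dual point is \<open>a\<close> divided by
  \<open>- \<mu>\<close>.\<close>

lemma strong_duality:
  fixes C :: "(real^'m) set" and A :: "'n::finite \<Rightarrow> real^'m"
  assumes cone: "convex_cone C" and "primal_strictly_feasible C A B"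
    and p: "\<And>x. x \<in> primal_feasible C A B \<Longrightarrow> p \<le> primal_objective c x"
  shows "\<exists>Y\<in>dual_feasible C A c. p \<le> B \<bullet> Y"
proof -
  let ?W = "range (\<lambda>x. (primal_slack A B x, primal_objective c x))"
  have lin: "linear (\<lambda>x. (\<Sum>i\<in>UNIV. x $ i *\<^sub>R A i, primal_objective c x))"
    by (intro linearI)
      (auto simp: primal_objective_def scaleR_add_left sum.distrib scaleR_sum_right
        distrib_left sum_distrib_left mult_ac)
  have W_eq: "?W = (\<lambda>w. w - (B, 0)) ` range (\<lambda>x. (\<Sum>i\<in>UNIV. x $ i *\<^sub>R A i, primal_objective c x))"
    by (auto simp: primal_slack_def image_image)
  have "convex ?W"
    unfolding W_eq by (rule convex_translation_subtract[OF convex_linear_image[OF lin convex_UNIV]])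
  moreover have "convex (C \<times> {..<p})"
    using cone by (intro convex_Times) (auto simp: convex_cone_def)
  moreover have zero: "0 \<in> C"
    using cone by (simp add: convex_cone_contains_0)
  \<comment> \<open>A common point would come from a feasible \<open>x\<close> with objective below
    \<open>p\<close>.\<close>
  moreover have "?W \<inter> (C \<times> {..<p}) = {}"
    using p by (fastforce simp: primal_feasible_def)
  moreover have "C \<times> {..<p} \<noteq> {}"
    using zero lt_ex[of p] by auto
  ultimately obtain w b where w: "w \<noteq> 0" "\<forall>z\<in>?W. w \<bullet> z \<le> b" "\<forall>z\<in>C \<times> {..<p}. w \<bullet> z \<ge> b"
    using separating_hyperplane_sets[of ?W "C \<times> {..<p}"] by auto
  obtain a \<mu> where w_eq: "w = (a, \<mu>)" by (cases w)
  have affine: "a \<bullet> primal_slack A B x + \<mu> * primal_objective c x \<le> b" for x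
    using w(2) by (auto simp: w_eq)
  have lower: "b \<le> a \<bullet> X + \<mu> * t" if "X \<in> C" "t < p" for X t
    using w(3) that by (auto simp: w_eq)

  \<comment> \<open>\<open>?f\<close> is the linear part, in \<open>x\<close>, of the separating
    functional on \<open>?W\<close>. Being bounded above, it vanishes; its coefficients then give
    the dual equations up to the factor \<open>- \<mu>\<close>.\<close>
  let ?f = "\<lambda>x::real^'n. \<Sum>i\<in>UNIV. x $ i * (A i \<bullet> a + \<mu> * c $ i)"
  have eq: "a \<bullet> primal_slack A B x + \<mu> * primal_objective c x = ?f x - B \<bullet> a" for x
    by (simp add: inner_primal_slack primal_objective_def sum_distrib_left
        distrib_left sum.distrib mult_ac)
  have "linear ?f"
    using linear_vec_combination[of "\<lambda>i. A i \<bullet> a + \<mu> * c $ i"] by simp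
  moreover have "?f x \<le> b + B \<bullet> a" for x
    using affine[of x] eq[of x] by simp
  ultimately have f0: "?f x = 0" for x
    by (rule linear_bounded_above_imp_zero)
  have A_a: "A i \<bullet> a = - \<mu> * c $ i" for i
    using f0[of "axis i 1"] by (simp add: axis_def if_distrib if_distribR cong: if_cong)
  have Ba: "- (B \<bullet> a) \<le> b"
    using affine[of 0] eq[of 0] f0[of 0] by simp
  have a_nonneg: "a \<bullet> X \<ge> 0" if "X \<in> C" for X
    using cone lower[of _ "p - 1"] that
    by (intro cone_bounded_below_imp_nonneg[where b = "b - \<mu> * (p - 1)"]) (auto simp: diff_le_eq)
  have \<mu>t: "b \<le> \<mu> * t" if "t < p" for t
    using lower[OF zero that] by simp
  have \<mu>_le: "\<mu> \<le> 0"
  proof (rule ccontr)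
    assume pos: "\<not> \<mu> \<le> 0"
    \<comment> \<open>The first argument of \<open>min\<close> keeps \<open>t\<close> below
      \<open>p\<close>; the second pushes \<open>\<mu> * t\<close> below \<open>b\<close> when
      \<open>\<mu> > 0\<close>.\<close>
    have "b \<le> \<mu> * min (p - 1) (b / \<mu> - 1)"
      by (rule \<mu>t) simp
    also have "\<dots> \<le> \<mu> * (b / \<mu> - 1)"
      using pos by (intro mult_left_mono) auto
    also have "\<dots> = b - \<mu>"
      using pos by (simp add: right_diff_distrib)
    finally show False using pos by simp
  qed
  have b_le: "b \<le> \<mu> * p"
  proof (rule tendsto_lowerbound)
    show "((\<lambda>t. \<mu> * t) \<longlongrightarrow> \<mu> * p) (at_left p)"
      by (intro tendsto_intros)
    show "\<forall>\<^sub>F t in at_left p. b \<le> \<mu> * t"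
      using \<mu>t by (auto simp: eventually_at_filter)
  qed simp
  \<comment> \<open>If \<open>\<mu> = 0\<close>, then \<open>a\<close> is nonnegative on
    \<open>C\<close> but at most \<open>b \<le> 0\<close> on every slack. Coercivity at an interior
    slack forces \<open>a = 0\<close>, so the normal \<open>w\<close> would vanish.\<close>
  have "\<mu> \<noteq> 0"
  proof
    assume "\<mu> = 0"
    obtain x e where "e > 0" and
      e: "\<And>Y. \<forall>X\<in>C. X \<bullet> Y \<ge> 0 \<Longrightarrow> primal_slack A B x \<bullet> Y \<ge> e * norm Y"
      using assms(2) interior_inner_coercive unfolding primal_strictly_feasible_def by blast
    have "e * norm a \<le> a \<bullet> primal_slack A B x"
      using e[of a] a_nonneg by (simp add: inner_commute)
    also have "\<dots> \<le> 0"
      using affine[of x] b_le \<open>\<mu> = 0\<close> by simp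
    finally have "a = 0"
      using \<open>e > 0\<close> by (simp add: mult_le_0_iff)
    then show False
      using w(1) \<open>\<mu> = 0\<close> by (simp add: w_eq zero_prod_def)
  qed
  with \<mu>_le have "\<mu> < 0" by simp
  show ?thesis
  proof
    have "- \<mu> * p \<le> B \<bullet> a"
      using Ba b_le by linarith
    then show "p \<le> B \<bullet> ((1 / - \<mu>) *\<^sub>R a)"
      using \<open>\<mu> < 0\<close> by (simp add: field_simps)
    show "(1 / - \<mu>) *\<^sub>R a \<in> dual_feasible C A c"
      using \<open>\<mu> < 0\<close> a_nonneg
      by (auto simp: dual_feasible_def dual_cone_def A_a divide_nonneg_neg inner_commute[of a])
  qed
qed

theorem theorem8:
  fixes C :: "(real^'m) set"
    and A :: "'n::finite \<Rightarrow> real^'m"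
    and B :: "real^'m"
    and c :: "real^'n"
  assumes "closed C" and "convex_cone C"
    and "primal_strictly_feasible C A B"
    and "dual_strictly_feasible C A c"
  shows "primal_value C A B c = dual_value C A B c \<and>
    (\<exists>x\<in>primal_feasible C A B. ereal (primal_objective c x) = primal_value C A B c) \<and>
    (\<exists>Y\<in>dual_feasible C A c. ereal (B \<bullet> Y) = dual_value C A B c)"
proof -
  have "primal_feasible C A B \<noteq> {}"
    using assms(3) interior_subset by (auto simp: primal_strictly_feasible_def primal_feasible_def)
  then obtain x where x: "x \<in> primal_feasible C A B"
    "\<And>z. z \<in> primal_feasible C A B \<Longrightarrow> primal_objective c x \<le> primal_objective c z"
    using primal_attained[OF assms(1,4)] by blast
  have "dual_feasible C A c \<noteq> {}"
    using assms(4) interior_subset by (auto simp: dual_strictly_feasible_def dual_feasible_def)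
  then obtain Y where Y: "Y \<in> dual_feasible C A c"
    "\<And>Z. Z \<in> dual_feasible C A c \<Longrightarrow> B \<bullet> Z \<le> B \<bullet> Y"
    using dual_attained[OF assms(3)] by blast
  \<comment> \<open>Strong duality with \<open>p\<close> the attained primal minimum gives a dual
    feasible point of value at least \<open>p\<close>, and \<open>Y\<close> is at least as
    good.\<close>
  have "primal_objective c x \<le> B \<bullet> Y"
    using strong_duality[OF assms(2,3) x(2)] Y(2) by fastforce
  then have "primal_objective c x = B \<bullet> Y"
    using weak_duality[OF x(1) Y(1)] by simp
  moreover have "primal_value C A B c = ereal (primal_objective c x)"
    unfolding primal_value_def using x by (intro antisym INF_lower INF_greatest) auto
  moreover have "dual_value C A B c = ereal (B \<bullet> Y)"
    unfolding dual_value_def using Y by (intro antisym SUP_upper SUP_least) auto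
  ultimately show ?thesis
    using x(1) Y(1) by metis
qed

end
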